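(* Let $\Omega\subseteq\mathbb{R}^2$ be an open bounded set such that for some $(s_0,t_0)\in\mathbb{R}^2$ and some $\varepsilon>0$ one has $\{s_0\}\times[t_0-\varepsilon,t_0)\subseteq\Omega$ and $(s_0,t_0)\in\partial\Omega$. Let $\phi\colon\overline{\Omega}\to\mathbb{R}^{1+2}$ be a $C^1$ map such that $\phi|_\Omega$ is a $C^2$ timelike immersion, and such that $\phi$ is of the form $\phi(s,t)=(t,\gamma(s,t))$, where $\gamma$ satisfies $\langle\gamma_s(s_0,t),\gamma_t(s_0,t)\rangle=0$ for $t\in[t_0-\varepsilon,t_0)$. Write $h$ for the mean curvature scalar of $\phi$, and $k(\cdot,t)$ for the curvature of the planar curves $\gamma(\cdot,t)$. Suppose that there is a constant $C$ with $|h(s,t)|\le C$ for all $(s,t)\in\Omega$, and that $|\gamma_t(s_0,t_0)|^2=1$. Then $$\int_{t_0-\varepsilon}^{t_0}|k(s_0,t)|\,dt=\infty.$$ In particular, $\limsup_{t\nearrow t_0}|k(s_0,t)|=\infty$.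
   Context: $\mathbb{R}^{1+2}$ is $\mathbb{R}^3$ with coordinates $(x^0,x^1,x^2)$ and the Minkowski metric $\eta=-(dx^0)^2+(dx^1)^2+(dx^2)^2$; $\langle\cdot,\cdot\rangle$ and $|\cdot|$ are the Euclidean inner product and norm on $\mathbb{R}^2$. For an immersion $\phi$ the induced bilinear form is $g_p(X,Y)=\eta(d\phi_p(X),d\phi_p(Y))$; $\phi$ is timelike if $\det g_p<0$ at every $p$. The mean curvature scalar of a $C^2$ timelike immersion is the trace, with respect to $g$, of the second fundamental form taken with respect to a spacelike $\eta$-unit normal (its sign depends on the choice of normal). $C^1$ on $\overline\Omega$ means that $\phi$ and its first partial derivatives on $\Omega$ extend continuously to $\overline\Omega$. *)

theory Defs
  imports "HOL-Analysis.Analysis"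
begin

text \<open>Parameters \<open>(s, t)\<close> live in \<^typ>\<open>real \<times> real\<close>, and \<open>R^{1+2}\<close> is
  \<^typ>\<open>real \<times> (real^2)\<close>, whose first component is the time coordinate.\<close>

type_synonym spacetime = "real \<times> (real^2)"

definition minkowski :: "spacetime \<Rightarrow> spacetime \<Rightarrow> real" where
  "minkowski v w = - (fst v * fst w) + snd v \<bullet> snd w"

text \<open>The index type \<^typ>\<open>2\<close> has the elements \<open>1\<close> and \<open>2 = 0\<close>; index \<open>1\<close> is the direction
  of \<open>s\<close> and index \<open>2\<close> that of \<open>t\<close>.\<close>

definition param_basis :: "2 \<Rightarrow> real \<times> real" where
  "param_basis i = (if i = 1 then (1, 0) else (0, 1))"

definition partial :: "2 \<Rightarrow> (real \<times> real \<Rightarrow> 'a::real_normed_vector) \<Rightarrow> real \<times> real \<Rightarrow> 'a" where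
  "partial i f p = vector_derivative (\<lambda>x. f (p + x *\<^sub>R param_basis i)) (at 0)"

text \<open>The next two notions are meant for an open set \<open>S\<close>.\<close>

definition C1_on :: "(real \<times> real) set \<Rightarrow> (real \<times> real \<Rightarrow> 'a::real_normed_vector) \<Rightarrow> bool" where
  "C1_on S f \<longleftrightarrow> (\<forall>p\<in>S. f differentiable at p) \<and> (\<forall>i. continuous_on S (partial i f))"

definition C2_on :: "(real \<times> real) set \<Rightarrow> (real \<times> real \<Rightarrow> 'a::real_normed_vector) \<Rightarrow> bool" where
  "C2_on S f \<longleftrightarrow> C1_on S f \<and> (\<forall>i. C1_on S (partial i f))"

text \<open>\<open>C^1\<close> on the closure of the open set \<open>S\<close>. The values of \<open>f\<close> outside \<^term>\<open>closure S\<close>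
  do not matter.\<close>

definition C1_on_closure :: "(real \<times> real) set \<Rightarrow> (real \<times> real \<Rightarrow> 'a::real_normed_vector) \<Rightarrow> bool" where
  "C1_on_closure S f \<longleftrightarrow> continuous_on (closure S) f \<and> C1_on S f \<and>
     (\<forall>i. \<exists>g. continuous_on (closure S) g \<and> (\<forall>p\<in>S. g p = partial i f p))"

text \<open>The value at \<open>p\<close> of the continuous extension of a partial derivative from \<open>S\<close> to
  \<^term>\<open>closure S\<close>.\<close>

definition partial_ext ::
  "(real \<times> real) set \<Rightarrow> 2 \<Rightarrow> (real \<times> real \<Rightarrow> 'a::real_normed_vector) \<Rightarrow> real \<times> real \<Rightarrow> 'a" where
  "partial_ext S i f p = Lim (at p within S) (partial i f)"

definition immersion_on :: "(real \<times> real) set \<Rightarrow> (real \<times> real \<Rightarrow> spacetime) \<Rightarrow> bool" where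
  "immersion_on S \<phi> \<longleftrightarrow>
     (\<forall>p\<in>S. \<phi> differentiable at p \<and> inj (frechet_derivative \<phi> (at p)))"

definition induced_form ::
  "(real \<times> real \<Rightarrow> spacetime) \<Rightarrow> real \<times> real \<Rightarrow> real \<times> real \<Rightarrow> real \<times> real \<Rightarrow> real" where
  "induced_form \<phi> p X Y =
     minkowski (frechet_derivative \<phi> (at p) X) (frechet_derivative \<phi> (at p) Y)"

definition induced_matrix :: "(real \<times> real \<Rightarrow> spacetime) \<Rightarrow> real \<times> real \<Rightarrow> real^2^2" where
  "induced_matrix \<phi> p = (\<chi> i j. induced_form \<phi> p (param_basis i) (param_basis j))"

definition timelike_on :: "(real \<times> real) set \<Rightarrow> (real \<times> real \<Rightarrow> spacetime) \<Rightarrow> bool" where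
  "timelike_on S \<phi> \<longleftrightarrow> (\<forall>p\<in>S. det (induced_matrix \<phi> p) < 0)"

definition unit_normal :: "(real \<times> real \<Rightarrow> spacetime) \<Rightarrow> real \<times> real \<Rightarrow> spacetime \<Rightarrow> bool" where
  "unit_normal \<phi> p n \<longleftrightarrow>
     minkowski n n = 1 \<and> (\<forall>X. minkowski n (frechet_derivative \<phi> (at p) X) = 0)"

text \<open>The ambient connection is flat, so the second fundamental form with respect to the unit
  normal field \<open>\<nu>\<close> has the components \<open>\<eta>(\<partial>\<^sub>i\<partial>\<^sub>j \<phi>, \<nu>)\<close>. It is tensorial in \<open>\<nu>\<close>: no
  derivative of \<open>\<nu>\<close> is involved.\<close>

definition second_fundamental_matrix ::
  "(real \<times> real \<Rightarrow> spacetime) \<Rightarrow> (real \<times> real \<Rightarrow> spacetime) \<Rightarrow> real \<times> real \<Rightarrow> real^2^2" where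
  "second_fundamental_matrix \<phi> \<nu> p = (\<chi> i j. minkowski (partial i (partial j \<phi>) p) (\<nu> p))"

definition mean_curvature ::
  "(real \<times> real \<Rightarrow> spacetime) \<Rightarrow> (real \<times> real \<Rightarrow> spacetime) \<Rightarrow> real \<times> real \<Rightarrow> real" where
  "mean_curvature \<phi> \<nu> p =
     trace (matrix_inv (induced_matrix \<phi> p) ** second_fundamental_matrix \<phi> \<nu> p)"

text \<open>Signed curvature \<open>det(c', c'') / |c'|^3\<close> of a regular planar curve.\<close>

definition plane_curvature :: "(real \<Rightarrow> real^2) \<Rightarrow> real \<Rightarrow> real" where
  "plane_curvature c x =
     (let c' = vector_derivative c (at x);
          c'' = vector_derivative (\<lambda>y. vector_derivative c (at y)) (at x)
      in (c' $ 1 * c'' $ 2 - c' $ 2 * c'' $ 1) / norm c' ^ 3)"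

end

theory Submission
  imports Defs
begin

text \<open>Along the line \<open>s = s\<^sub>0\<close> the induced metric is diagonal, and \<open>h\<close> becomes, up to
  the factor relating the spacelike unit normal to the normal of the planar curve, the
  difference of \<open>k\<close> and of the normal part of \<open>\<gamma>\<^sub>t\<^sub>t / (1 - |\<gamma>\<^sub>t|\<^sup>2)\<close>. Since \<open>\<gamma>\<^sub>t\<close> is itself normal to the curve, this bounds the
  logarithmic derivative of \<open>1 - |\<gamma>\<^sub>t|\<^sup>2\<close> by \<open>2 (|k| + C)\<close>. As \<open>1 - |\<gamma>\<^sub>t|\<^sup>2\<close> is positive and
  tends to \<open>0\<close>, its logarithm is unbounded, so \<open>|k|\<close> cannot be integrable.\<close>

section \<open>Partial derivatives and the classes C1 and C2\<close>

lemma frechet_derivative_param_basis: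
  assumes "f differentiable at p"
  shows "((\<lambda>x. f (p + x *\<^sub>R param_basis i)) has_vector_derivative
           frechet_derivative f (at p) (param_basis i)) (at 0)"
proof -
  let ?D = "frechet_derivative f (at p)"
  have D: "(f has_derivative ?D) (at p)"
    using assms by (simp add: frechet_derivative_works)
  have "((\<lambda>x::real. p + x *\<^sub>R param_basis i) has_derivative (\<lambda>x. x *\<^sub>R param_basis i)) (at 0)"
    by (auto intro!: derivative_eq_intros)
  then have "((\<lambda>x. f (p + x *\<^sub>R param_basis i)) has_derivative (\<lambda>x. ?D (x *\<^sub>R param_basis i))) (at 0)"
    by (rule has_derivative_compose) (use D in simp)
  then show ?thesis
    using linear_frechet_derivative[OF assms] by (simp add: has_vector_derivative_def linear_cmul)
qed

lemma partial_eq_frechet_derivative: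
  assumes "f differentiable at p"
  shows "partial i f p = frechet_derivative f (at p) (param_basis i)"
  unfolding partial_def
  using frechet_derivative_param_basis[OF assms] by (rule vector_derivative_at)

text \<open>\<open>partial\<close> differentiates at 0 along a shifted line, curves are
  differentiated at the parameter itself; this passes between the two.\<close>

lemma has_vector_derivative_shift_iff:
  fixes f :: "real \<Rightarrow> 'a::real_normed_vector"
  shows "((\<lambda>x. f (a + x)) has_vector_derivative D) (at 0) \<longleftrightarrow> (f has_vector_derivative D) (at a)"
proof
  assume *: "((\<lambda>x. f (a + x)) has_vector_derivative D) (at 0)"
  have "((\<lambda>x. x - a) has_vector_derivative 1) (at a)"
    by (auto intro!: derivative_eq_intros)
  from vector_diff_chain_at[OF this, of "\<lambda>x. f (a + x)" D] *
  show "(f has_vector_derivative D) (at a)" by (simp add: o_def)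
next
  assume *: "(f has_vector_derivative D) (at a)"
  have "((\<lambda>x. a + x) has_vector_derivative 1) (at 0)"
    by (auto intro!: derivative_eq_intros)
  from vector_diff_chain_at[OF this, of f D] *
  show "((\<lambda>x. f (a + x)) has_vector_derivative D) (at 0)" by (simp add: o_def)
qed

text \<open>No differentiability is assumed: by the shift equivalence the same vectors qualify as
  derivatives on both sides, so the two Hilbert choices coincide.\<close>

lemma partial_1_Pair: "partial 1 f (s, t) = vector_derivative (\<lambda>x. f (x, t)) (at s)"
  using has_vector_derivative_shift_iff[of "\<lambda>x. f (x, t)" s]
  by (simp add: partial_def param_basis_def vector_derivative_def)

lemma has_vector_derivative_partial_2:
  assumes "f differentiable at (s, t)"
  shows "((\<lambda>x. f (s, x)) has_vector_derivative partial 2 f (s, t)) (at t)"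
  using frechet_derivative_param_basis[OF assms, of 2]
    has_vector_derivative_shift_iff[of "\<lambda>x. f (s, x)" t]
  by (simp add: partial_eq_frechet_derivative[OF assms] param_basis_def)

lemma partial_bounded_linear:
  assumes "bounded_linear L" "f differentiable at p"
  shows "partial i (\<lambda>q. L (f q)) p = L (partial i f p)"
  unfolding partial_eq_frechet_derivative[OF assms(2)]
  unfolding partial_def
  by (intro vector_derivative_at bounded_linear.has_vector_derivative[OF assms(1)]
      frechet_derivative_param_basis assms(2))

lemma differentiable_cong_open:
  assumes "open S" "p \<in> S" "\<And>q. q \<in> S \<Longrightarrow> f q = g q" "f differentiable at p"
  shows "g differentiable at p"
  using assms has_derivative_transform_within_open unfolding differentiable_def by blast

text \<open>Derivatives are local. This matters because \<phi> is given as (t, \<gamma>) only on the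
  closure of \<Omega>.\<close>

lemma partial_cong_open:
  assumes "open S" "p \<in> S" "\<And>q. q \<in> S \<Longrightarrow> f q = g q"
  shows "partial i f p = partial i g p"
proof -
  have "((\<lambda>x::real. p + x *\<^sub>R param_basis i) \<longlongrightarrow> p + 0 *\<^sub>R param_basis i) (nhds 0)"
    by (intro tendsto_intros filterlim_ident)
  then have "\<forall>\<^sub>F x in nhds (0::real). p + x *\<^sub>R param_basis i \<in> S"
    using topological_tendstoD assms(1,2) by fastforce
  then have "\<forall>\<^sub>F x in nhds 0. f (p + x *\<^sub>R param_basis i) = g (p + x *\<^sub>R param_basis i)"
    by eventually_elim (rule assms(3))
  then show ?thesis
    unfolding partial_def by (intro vector_derivative_cong_eq) auto
qed

lemma C1_on_bounded_linear:
  assumes "bounded_linear L" "C1_on S f"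
  shows "C1_on S (\<lambda>q. L (f q))"
proof -
  have "(\<lambda>q. L (f q)) differentiable at p" if "p \<in> S" for p
    using assms that bounded_linear.has_derivative[OF assms(1)]
    unfolding C1_on_def differentiable_def by blast
  moreover have "continuous_on S (partial i (\<lambda>q. L (f q)))" for i
  proof (rule continuous_on_eq)
    show "continuous_on S (\<lambda>p. L (partial i f p))"
      using assms by (auto simp: C1_on_def intro: bounded_linear.continuous_on)
    show "L (partial i f p) = partial i (\<lambda>q. L (f q)) p" if "p \<in> S" for p
      using assms that by (simp add: partial_bounded_linear C1_on_def)
  qed
  ultimately show ?thesis by (simp add: C1_on_def)
qed

lemma C1_on_cong:
  assumes "open S" "\<And>q. q \<in> S \<Longrightarrow> f q = g q" "C1_on S f"
  shows "C1_on S g"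
proof -
  have "continuous_on S (partial i g)" for i
    using assms(3) continuous_on_eq[of S "partial i f"] partial_cong_open[OF assms(1) _ assms(2)]
    by (auto simp: C1_on_def)
  then show ?thesis
    using assms differentiable_cong_open[OF assms(1) _ assms(2)] by (auto simp: C1_on_def)
qed

lemma C2_on_bounded_linear:
  assumes "open S" "bounded_linear L" "C2_on S f"
  shows "C2_on S (\<lambda>q. L (f q))"
proof -
  have "C1_on S (partial i (\<lambda>q. L (f q)))" for i
  proof (rule C1_on_cong[OF assms(1)])
    show "C1_on S (\<lambda>p. L (partial i f p))"
      using assms by (auto simp: C2_on_def intro: C1_on_bounded_linear)
    show "L (partial i f p) = partial i (\<lambda>q. L (f q)) p" if "p \<in> S" for p
      using assms that by (simp add: partial_bounded_linear C2_on_def C1_on_def)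
  qed
  then show ?thesis using assms by (simp add: C2_on_def C1_on_bounded_linear)
qed

lemma C2_on_cong:
  assumes "open S" "\<And>q. q \<in> S \<Longrightarrow> f q = g q" "C2_on S f"
  shows "C2_on S g"
proof -
  have "C1_on S (partial i g)" for i
    by (rule C1_on_cong[OF assms(1) partial_cong_open[OF assms(1) _ assms(2)]])
      (use assms(3) in \<open>auto simp: C2_on_def\<close>)
  moreover have "C1_on S g"
    by (rule C1_on_cong[OF assms(1,2)]) (use assms(3) in \<open>auto simp: C2_on_def\<close>)
  ultimately show ?thesis by (simp add: C2_on_def)
qed

section \<open>Linear algebra of diagonal metrics and of the plane\<close>

lemma matrix_inv_diagonal_2:
  fixes A :: "real^2^2"
  assumes "A $ 1 $ 2 = 0" "A $ 2 $ 1 = 0" "A $ 1 $ 1 \<noteq> 0" "A $ 2 $ 2 \<noteq> 0"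
  shows "matrix_inv A = (\<chi> i j. if i = j then 1 / A $ i $ i else 0)" (is "_ = ?B")
proof -
  have B: "A ** ?B = mat 1" "?B ** A = mat 1"
    using assms by (auto simp: matrix_matrix_mult_def mat_def vec_eq_iff forall_2 sum_2)
  \<comment> \<open>\<open>matrix_inv\<close> is a Hilbert choice: \<open>?B\<close> witnesses that
    the chosen matrix is an inverse, and uniqueness of inverses then identifies it with
    \<open>?B\<close>.\<close>
  have "A ** matrix_inv A = mat 1 \<and> matrix_inv A ** A = mat 1"
    unfolding matrix_inv_def by (rule someI[of _ ?B]) (use B in blast)
  then have "?B ** A ** matrix_inv A = ?B"
    by (simp flip: matrix_mul_assoc)
  then show ?thesis using B by simp
qed

text \<open>For a diagonal metric the off-diagonal entries of \<open>B\<close> drop out of the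
  trace; this is how the mixed derivatives of \<phi> disappear from the mean curvature.\<close>

lemma trace_matrix_inv_diagonal_2:
  fixes A :: "real^2^2"
  assumes "A $ 1 $ 2 = 0" "A $ 2 $ 1 = 0" "A $ 1 $ 1 \<noteq> 0" "A $ 2 $ 2 \<noteq> 0"
  shows "trace (matrix_inv A ** B) = B $ 1 $ 1 / A $ 1 $ 1 + B $ 2 $ 2 / A $ 2 $ 2"
  unfolding matrix_inv_diagonal_2[OF assms]
  by (simp add: trace_def matrix_matrix_mult_def sum_2)

text \<open>The orthogonal complement of \<open>a\<close> is spanned by the rotated vector
  \<open>Ja = (- a $ 2, a $ 1)\<close>, so \<open>b = r Ja\<close>. Both conclusions follow, as
  \<open>Ja\<close> is as long as \<open>a\<close> and \<open>w \<bullet> Ja\<close> is the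
  determinant of \<open>a\<close> and \<open>w\<close>.\<close>

lemma inner_orthogonal_planar:
  fixes a b :: "real^2"
  assumes "a \<bullet> b = 0" "a \<noteq> 0"
  obtains r where "b \<bullet> b = r\<^sup>2 * (a \<bullet> a)"
    and "\<And>w. w \<bullet> b = r * (a $ 1 * w $ 2 - a $ 2 * w $ 1)"
proof -
  have pos: "a \<bullet> a \<noteq> 0" using assms(2) by simp
  define r where "r = (a $ 1 * b $ 2 - a $ 2 * b $ 1) / (a \<bullet> a)"
  have eq: "a $ 1 * b $ 1 + a $ 2 * b $ 2 = 0" and aa: "a \<bullet> a = a $ 1 * a $ 1 + a $ 2 * a $ 2"
    using assms(1) by (simp_all add: inner_vec_def sum_2)
  have r: "r * (a \<bullet> a) = a $ 1 * b $ 2 - a $ 2 * b $ 1"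
    using pos by (simp add: r_def)
  have "(b $ 1 + r * a $ 2) * (a \<bullet> a) = a $ 1 * (a $ 1 * b $ 1 + a $ 2 * b $ 2)"
    using r aa by algebra
  then have 1: "b $ 1 = - r * a $ 2" using eq pos by simp
  have "(b $ 2 - r * a $ 1) * (a \<bullet> a) = a $ 2 * (a $ 1 * b $ 1 + a $ 2 * b $ 2)"
    using r aa by algebra
  then have 2: "b $ 2 = r * a $ 1" using eq pos by simp
  show thesis
    by (rule that[of r])
      (simp_all add: inner_vec_def sum_2 1 2 power2_eq_square algebra_simps)
qed

text \<open>Read \<open>a\<close>, \<open>b\<close>, \<open>z\<close>, \<open>w\<close> as
  \<open>\<gamma>\<^sub>s\<close>, \<open>\<gamma>\<^sub>t\<close>,
  \<open>\<gamma>\<^sub>s\<^sub>s\<close>, \<open>\<gamma>\<^sub>t\<^sub>t\<close> and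
  \<open>n\<close> as the spatial part of the unit normal. Both \<open>b\<close> and
  \<open>n\<close> are multiples of the rotated \<open>a\<close>, so the formula for the mean
  curvature can be solved for \<open>b \<bullet> w\<close>. The coefficients that arise are at most
  1 in size because \<open>b\<close> has length below 1 and \<open>n\<close> length at least
  1.\<close>

lemma acceleration_bound:
  fixes a b n w z :: "real^2"
  assumes "a \<noteq> 0" "a \<bullet> b = 0" "b \<bullet> b < 1"
    and "n \<bullet> a = 0" "n \<bullet> n - (n \<bullet> b)\<^sup>2 = 1"
  shows "\<bar>b \<bullet> w\<bar> \<le> (1 - b \<bullet> b) * (\<bar>(a $ 1 * z $ 2 - a $ 2 * z $ 1) / norm a ^ 3\<bar>
            + \<bar>z \<bullet> n / (a \<bullet> a) + w \<bullet> n / (b \<bullet> b - 1)\<bar>)"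
proof -
  obtain r where r: "b \<bullet> b = r\<^sup>2 * (a \<bullet> a)"
    and rw: "\<And>w. w \<bullet> b = r * (a $ 1 * w $ 2 - a $ 2 * w $ 1)"
    using inner_orthogonal_planar[OF assms(2,1)] by metis
  obtain m where m: "n \<bullet> n = m\<^sup>2 * (a \<bullet> a)"
    and mw: "\<And>w. w \<bullet> n = m * (a $ 1 * w $ 2 - a $ 2 * w $ 1)"
    using inner_orthogonal_planar[of a n] assms(1,4) by (metis inner_commute)
  define A where "A = norm a"
  define u where "u = 1 - b \<bullet> b"
  define D where "D = a $ 1 * z $ 2 - a $ 2 * z $ 1"
  define W where "W = a $ 1 * w $ 2 - a $ 2 * w $ 1"
  define H where "H = z \<bullet> n / (a \<bullet> a) + w \<bullet> n / (b \<bullet> b - 1)"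
  have A: "A > 0" "a \<bullet> a = A\<^sup>2" using assms(1) by (simp_all add: A_def dot_square_norm)
  have u: "u > 0" "b \<bullet> b - 1 = - u" using assms(3) by (simp_all add: u_def)
  have rA: "\<bar>r * A\<bar> \<le> 1"
  proof -
    have "(r * A)\<^sup>2 \<le> 1" using assms(3) r A by (simp add: power_mult_distrib)
    then show ?thesis by (simp only: abs_square_le_1)
  qed
  \<comment> \<open>The Minkowski normalisation gives \<open>n\<close> length at least 1, so
    \<open>m\<close> is non-zero and dominates \<open>r\<close>.\<close>
  have "n \<bullet> n = 1 + (n \<bullet> b)\<^sup>2" using assms(5) by simp
  then have "1\<^sup>2 \<le> (m * A)\<^sup>2" using m A by (simp add: power_mult_distrib)
  then have mA: "1 \<le> \<bar>m * A\<bar>"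
    by (metis abs_le_square_iff abs_one)
  then have m0: "m \<noteq> 0" by auto
  have "\<bar>r\<bar> * A \<le> \<bar>m\<bar> * A"
    using order_trans[OF rA mA] A(1) by (simp only: abs_mult abs_of_pos)
  then have "\<bar>r\<bar> \<le> \<bar>m\<bar>" using A(1) by (simp only: mult_le_cancel_right_pos)
  then have rm: "\<bar>r / m\<bar> \<le> 1" using m0 by (simp add: abs_divide)
  have H: "H = m * D / A\<^sup>2 - m * W / u"
    by (simp add: H_def mw D_def W_def A u)
  \<comment> \<open>The equation for \<open>H\<close>, solved for \<open>W\<close> and multiplied by
    \<open>r\<close>.\<close>
  have "r * W = u * (r * A * (D / A ^ 3) - r / m * H)"
    using A u m0 unfolding H by (simp add: field_simps power2_eq_square power3_eq_cube)
  then have "\<bar>b \<bullet> w\<bar> = u * \<bar>r * A * (D / A ^ 3) - r / m * H\<bar>"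
    using rw[of w] u by (simp add: inner_commute W_def abs_mult)
  also have "\<dots> \<le> u * (\<bar>r * A\<bar> * \<bar>D / A ^ 3\<bar> + \<bar>r / m\<bar> * \<bar>H\<bar>)"
    unfolding abs_mult[symmetric] using u by (intro mult_left_mono abs_triangle_ineq4) simp
  also have "\<dots> \<le> u * (1 * \<bar>D / A ^ 3\<bar> + 1 * \<bar>H\<bar>)"
    using u by (intro mult_left_mono add_mono mult_right_mono rA rm) auto
  finally show ?thesis by (simp add: u_def D_def A_def H_def)
qed

section \<open>Logarithmic derivatives and divergent integrals\<close>

text \<open>If \<open>K\<close> had a finite integral, integrating the bound on
  \<open>u' / u\<close> over \<open>{a..T}\<close> would bound \<open>ln (u T)\<close> below
  independently of \<open>T\<close>, so \<open>u\<close> could not tend to 0.\<close>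

lemma nn_integral_infinite_if_log_derivative_bounded:
  fixes u u' K :: "real \<Rightarrow> real"
  assumes "a < b"
    and der: "\<And>t. t \<in> {a..<b} \<Longrightarrow> (u has_real_derivative u' t) (at t)"
    and pos: "\<And>t. t \<in> {a..<b} \<Longrightarrow> u t > 0"
    and bound: "\<And>t. t \<in> {a..<b} \<Longrightarrow> \<bar>u' t\<bar> \<le> u t * (2 * (K t + C))"
    and K0: "\<And>t. t \<in> {a..<b} \<Longrightarrow> K t \<ge> 0"
    and cont: "continuous_on {a..<b} K"
    and lim: "(u \<longlongrightarrow> 0) (at_left b)"
  shows "(\<integral>\<^sup>+t\<in>{a..<b}. ennreal (K t) \<partial>lborel) = \<infinity>"
proof (rule ccontr)
  let ?I = "\<integral>\<^sup>+t\<in>{a..<b}. ennreal (K t) \<partial>lborel"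
  assume "?I \<noteq> \<infinity>"
  then obtain B where B: "B \<ge> 0" "?I = ennreal B" by (cases ?I) auto
  \<comment> \<open>The subtracted term bounds the integral of
    \<open>2 * (K t + \<bar>C\<bar>)\<close> over every \<open>{a..T}\<close>; the absolute value
    allows \<open>T - a\<close> to be enlarged to \<open>b - a\<close> whatever the sign of
    \<open>C\<close>.\<close>
  define M where "M = ln (u a) - 2 * (B + \<bar>C\<bar> * (b - a))"
  have lower: "M \<le> ln (u T)" if T: "T \<in> {a..<b}" for T
  proof -
    have sub: "{a..T} \<subseteq> {a..<b}" using T by auto
    have "(\<lambda>t. u' t / u t) integrable_on {a..T} \<and> integral {a..T} (\<lambda>t. u' t / u t) = ln (u T) - ln (u a)"
    proof -
      have "((\<lambda>t. u' t / u t) has_integral ln (u T) - ln (u a)) {a..T}"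
      proof (rule fundamental_theorem_of_calculus)
        show "((\<lambda>t. ln (u t)) has_vector_derivative u' x / u x) (at x within {a..T})"
          if "x \<in> {a..T}" for x
        proof -
          have "((\<lambda>t. ln (u t)) has_real_derivative u' x / u x) (at x)"
            using der[of x] pos[of x] that sub by (auto intro!: derivative_eq_intros)
          then show ?thesis
            using has_real_derivative_iff_has_vector_derivative has_vector_derivative_at_within
            by blast
        qed
      qed (use T in auto)
      then show ?thesis by (auto simp: has_integral_iff)
    qed
    note FTC = this
    have cK: "continuous_on {a..T} K" using cont sub continuous_on_subset by blast
    then have iK: "K integrable_on {a..T}" by (rule integrable_continuous_real)
    \<comment> \<open>\<open>B\<close> bounds a Lebesgue integral, while the fundamental theorem
      speaks of the gauge integral. For the nonnegative continuous \<open>K\<close> on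
      \<open>{a..T}\<close> they agree, and enlarging the domain to \<open>{a..<b}\<close> can only
      increase the former.\<close>
    have "(\<lambda>t. K t * indicator {a..T} t) \<in> borel_measurable borel"
      using borel_measurable_continuous_on_indicator[OF _ cK] by (simp add: mult.commute)
    moreover have "((\<lambda>t. K t * indicator {a..T} t) has_integral integral {a..T} K) UNIV"
    proof -
      have "(\<lambda>t. K t * indicator {a..T} t) = (\<lambda>t. if t \<in> {a..T} then K t else 0)"
        by (auto simp: indicator_def)
      then show ?thesis
        using integrable_integral[OF iK] by (simp only: has_integral_restrict_UNIV)
    qed
    ultimately have "(\<integral>\<^sup>+t. ennreal (K t * indicator {a..T} t) \<partial>lborel) = ennreal (integral {a..T} K)"
      using K0 sub by (intro nn_integral_has_integral_lborel) (auto simp: indicator_def)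
    moreover have "(\<integral>\<^sup>+t. ennreal (K t * indicator {a..T} t) \<partial>lborel) \<le> ?I"
      using sub by (intro nn_integral_mono) (auto simp: indicator_def)
    ultimately have "integral {a..T} K \<le> B" using B by simp
    have ig: "(\<lambda>t. 2 * (K t + \<bar>C\<bar>)) integrable_on {a..T}"
      by (intro integrable_continuous_real continuous_intros cK)
    have "norm (integral {a..T} (\<lambda>t. u' t / u t)) \<le> integral {a..T} (\<lambda>t. 2 * (K t + \<bar>C\<bar>))"
    proof (rule integral_norm_bound_integral[OF _ ig])
      show "norm (u' t / u t) \<le> 2 * (K t + \<bar>C\<bar>)" if "t \<in> {a..T}" for t
      proof -
        have t: "t \<in> {a..<b}" using that sub by auto
        have "\<bar>u' t\<bar> \<le> u t * (2 * (K t + \<bar>C\<bar>))"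
          using pos[OF t] by (intro order_trans[OF bound[OF t]] mult_left_mono) auto
        then show ?thesis using pos[OF t] by (simp add: abs_divide divide_le_eq mult.commute)
      qed
    qed (use FTC in simp)
    also have "\<dots> = 2 * (integral {a..T} K + \<bar>C\<bar> * (T - a))"
      using iK T by (simp add: integral_add integrable_const_ivl mult.commute del: distrib_left_numeral)
    also have "\<dots> \<le> 2 * (B + \<bar>C\<bar> * (b - a))"
      using \<open>integral {a..T} K \<le> B\<close> T by (intro mult_left_mono add_mono) auto
    finally show ?thesis using FTC by (simp add: M_def)
  qed
  \<comment> \<open>Close to \<open>b\<close> the function falls below \<open>exp M\<close>, against
    the lower bound; such points exist because \<open>at_left b\<close> is a proper filter.\<close>
  have "\<forall>\<^sub>F t in at_left b. u t < exp M"
    using lim by (rule order_tendstoD) simp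
  moreover have "\<forall>\<^sub>F t in at_left b. t \<in> {a..<b}"
    using eventually_at_left_real[OF assms(1)] by eventually_elim auto
  ultimately have "\<forall>\<^sub>F t in at_left b. False"
  proof eventually_elim
    case (elim t)
    then have "ln (u t) < M" using pos[of t] by (metis exp_less_cancel_iff exp_ln)
    then show False using lower[of t] elim by simp
  qed
  then show False by simp
qed

text \<open>A finite upper limit bounds \<open>K\<close> above near \<open>b\<close>, and continuity
  bounds it on the compact rest. The integral over the bounded interval is then finite, since
  \<open>ennreal\<close> cuts off negative values.\<close>

lemma Limsup_at_left_infinite_if_nn_integral_infinite:
  fixes K :: "real \<Rightarrow> real"
  assumes "a < b" "continuous_on {a..<b} K"
    and inf: "(\<integral>\<^sup>+t\<in>{a..<b}. ennreal (K t) \<partial>lborel) = \<infinity>"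
  shows "Limsup (at_left b) (\<lambda>t. ereal (K t)) = \<infinity>"
proof (rule ccontr)
  assume "Limsup (at_left b) (\<lambda>t. ereal (K t)) \<noteq> \<infinity>"
  then obtain M where "Limsup (at_left b) (\<lambda>t. ereal (K t)) < ereal M"
    using less_PInf_Ex_of_nat ereal_infty_less(1) by (metis ereal_less_PInfty)
  then have "\<forall>\<^sub>F t in at_left b. ereal (K t) < ereal M" by (rule Limsup_lessD)
  then obtain d where d: "d < b" "\<And>t. d < t \<Longrightarrow> t < b \<Longrightarrow> K t < M"
    by (auto simp: eventually_at_left_field)
  \<comment> \<open>\<open>d\<close> may lie to the left of \<open>a\<close>; the interval is then
    empty and any \<open>N\<close> serves.\<close>
  have "continuous_on {a..d} K" using assms(2) d(1) by (auto intro: continuous_on_subset)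
  then have "bounded (K ` {a..d})" by (intro compact_imp_bounded compact_continuous_image) auto
  then obtain N where N: "\<And>t. t \<in> {a..d} \<Longrightarrow> \<bar>K t\<bar> \<le> N" by (fastforce simp: bounded_iff)
  have "(\<integral>\<^sup>+t\<in>{a..<b}. ennreal (K t) \<partial>lborel)
      \<le> (\<integral>\<^sup>+t. ennreal (max M N) * indicator {a..<b} t \<partial>lborel)"
  proof (intro nn_integral_mono)
    fix t
    have "K t \<le> max M N" if "t \<in> {a..<b}"
      using d(2)[of t] N[of t] that by (cases "t \<le> d") auto
    then show "ennreal (K t) * indicator {a..<b} t \<le> ennreal (max M N) * indicator {a..<b} t"
      by (auto simp: indicator_def intro!: ennreal_leI)
  qed
  also have "\<dots> = ennreal (max M N) * ennreal (b - a)"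
    using assms(1) by (simp add: nn_integral_cmult_indicator)
  also have "\<dots> < \<infinity>" by (simp flip: ennreal_mult' add: ennreal_mult_less_top)
  finally show False using inf by simp
qed

text \<open>The normal \<nu> is chosen pointwise, which is harmless as its sign does not affect |h|.
  The integral omits only the null set at \<open>t0\<close>, where the point lies outside the open
  set \<Omega>.\<close>

theorem proposition4p1:
  fixes \<Omega> :: "(real \<times> real) set"
    and s0 t0 \<epsilon> C :: real
    and \<phi> :: "real \<times> real \<Rightarrow> spacetime"
    and \<gamma> :: "real \<times> real \<Rightarrow> real^2"
    and \<nu> :: "real \<times> real \<Rightarrow> spacetime"
  assumes "open \<Omega>" and "bounded \<Omega>"
    and "\<epsilon> > 0"
    and "{s0} \<times> {t0 - \<epsilon>..<t0} \<subseteq> \<Omega>"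
    and "(s0, t0) \<in> frontier \<Omega>"
    and "C1_on_closure \<Omega> \<phi>"
    and "C2_on \<Omega> \<phi>" and "immersion_on \<Omega> \<phi>" and "timelike_on \<Omega> \<phi>"
    and "\<And>s t. (s, t) \<in> closure \<Omega> \<Longrightarrow> \<phi> (s, t) = (t, \<gamma> (s, t))"
    and "\<And>t. t \<in> {t0 - \<epsilon>..<t0} \<Longrightarrow> partial 1 \<gamma> (s0, t) \<bullet> partial 2 \<gamma> (s0, t) = 0"
    and "\<And>p. p \<in> \<Omega> \<Longrightarrow> unit_normal \<phi> p (\<nu> p)"
    and "\<And>s t. (s, t) \<in> \<Omega> \<Longrightarrow> \<bar>mean_curvature \<phi> \<nu> (s, t)\<bar> \<le> C"
    and "(norm (partial_ext \<Omega> 2 \<gamma> (s0, t0)))\<^sup>2 = 1"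
  shows "(\<integral>\<^sup>+t\<in>{t0 - \<epsilon>..<t0}. ennreal \<bar>plane_curvature (\<lambda>s. \<gamma> (s, t)) s0\<bar> \<partial>lborel) = \<infinity>
    \<and> Limsup (at_left t0) (\<lambda>t. ereal \<bar>plane_curvature (\<lambda>s. \<gamma> (s, t)) s0\<bar>) = \<infinity>"
proof -
  note [simp] = bounded_linear_fst bounded_linear_snd
  define a where "a = t0 - \<epsilon>"
  have ab: "a < t0" using assms(3) by (simp add: a_def)
  have line: "(s0, t) \<in> \<Omega>" if "t \<in> {a..<t0}" for t
    using assms(4) that by (auto simp: a_def)
  have form: "\<phi> p = (snd p, \<gamma> p)" if "p \<in> \<Omega>" for p
    using assms(10)[of "fst p" "snd p"] that closure_subset by auto
  have diff: "\<phi> differentiable at p" "partial i \<phi> differentiable at p" if "p \<in> \<Omega>" for p i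
    using assms(7) that by (auto simp: C2_on_def C1_on_def)
  have \<gamma>2: "C2_on \<Omega> \<gamma>"
    by (rule C2_on_cong[OF assms(1) _ C2_on_bounded_linear[OF assms(1) bounded_linear_snd assms(7)]])
      (simp add: form)

  \<comment> \<open>Derivatives of \<phi> in terms of \<gamma>\<close>
  have d\<phi>: "partial i \<phi> p = (if i = 1 then 0 else 1, partial i \<gamma> p)" if p: "p \<in> \<Omega>" for p i
  proof (rule prod_eqI)
    have "fst (partial i \<phi> p) = partial i (\<lambda>q. fst (\<phi> q)) p"
      using diff[OF p] by (simp add: partial_bounded_linear)
    also have "\<dots> = partial i snd p"
      by (rule partial_cong_open[OF assms(1) p]) (simp add: form)
    also have "\<dots> = (if i = 1 then 0 else 1)"
      using partial_bounded_linear[of snd "\<lambda>q. q" p i]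
        partial_eq_frechet_derivative[of "\<lambda>q. q" p i]
      by (simp add: frechet_derivative_ident param_basis_def)
    finally show "fst (partial i \<phi> p) = fst (if i = 1 then 0 else 1, partial i \<gamma> p)" by simp
    have "snd (partial i \<phi> p) = partial i (\<lambda>q. snd (\<phi> q)) p"
      using diff[OF p] by (simp add: partial_bounded_linear)
    also have "\<dots> = partial i \<gamma> p"
      by (rule partial_cong_open[OF assms(1) p]) (simp add: form)
    finally show "snd (partial i \<phi> p) = snd (if i = 1 then 0 else 1, partial i \<gamma> p)" by simp
  qed
  \<comment> \<open>The time components of the first partials are constant, so the second
    fundamental form reduces to Euclidean products with the spatial part of the normal.\<close>
  have dd\<phi>: "partial i (partial j \<phi>) p = (0, partial i (partial j \<gamma>) p)" if p: "p \<in> \<Omega>" for p i j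
  proof (rule prod_eqI)
    have "fst (partial i (partial j \<phi>) p) = partial i (\<lambda>q. fst (partial j \<phi> q)) p"
      using diff[OF p] by (simp add: partial_bounded_linear)
    also have "\<dots> = partial i (\<lambda>q. if j = 1 then 0 else 1) p"
      by (rule partial_cong_open[OF assms(1) p]) (simp add: d\<phi>)
    also have "\<dots> = 0" by (simp add: partial_def)
    finally show "fst (partial i (partial j \<phi>) p) = fst (0::real, partial i (partial j \<gamma>) p)" by simp
    have "snd (partial i (partial j \<phi>) p) = partial i (\<lambda>q. snd (partial j \<phi> q)) p"
      using diff[OF p] by (simp add: partial_bounded_linear)
    also have "\<dots> = partial i (partial j \<gamma>) p"
      by (rule partial_cong_open[OF assms(1) p]) (simp add: d\<phi>)
    finally show "snd (partial i (partial j \<phi>) p) = snd (0::real, partial i (partial j \<gamma>) p)" by simp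
  qed

  \<comment> \<open>Metric and mean curvature on the segment s = s0\<close>
  define gs where "gs t = partial 1 \<gamma> (s0, t)" for t
  define gt where "gt t = partial 2 \<gamma> (s0, t)" for t
  define gss where "gss t = partial 1 (partial 1 \<gamma>) (s0, t)" for t
  define gtt where "gtt t = partial 2 (partial 2 \<gamma>) (s0, t)" for t
  define k where "k t = \<bar>plane_curvature (\<lambda>s. \<gamma> (s, t)) s0\<bar>" for t
  have k: "k t = \<bar>(gs t $ 1 * gss t $ 2 - gs t $ 2 * gss t $ 1) / norm (gs t) ^ 3\<bar>" for t
    by (simp add: k_def plane_curvature_def Let_def gs_def gss_def partial_1_Pair)
  have orth: "gs t \<bullet> gt t = 0" if "t \<in> {a..<t0}" for t
    using assms(11)[of t] that by (simp add: gs_def gt_def a_def)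
  have metric: "induced_matrix \<phi> (s0, t) $ 1 $ 1 = gs t \<bullet> gs t"
    "induced_matrix \<phi> (s0, t) $ 1 $ 2 = 0"
    "induced_matrix \<phi> (s0, t) $ 2 $ 1 = 0"
    "induced_matrix \<phi> (s0, t) $ 2 $ 2 = gt t \<bullet> gt t - 1" if t: "t \<in> {a..<t0}" for t
    using orth[OF t] d\<phi>[OF line[OF t]]
    by (simp_all add: induced_matrix_def induced_form_def minkowski_def inner_commute gs_def gt_def
        flip: partial_eq_frechet_derivative[OF diff(1)[OF line[OF t]]])
  have timelike: "gs t \<noteq> 0" "gt t \<bullet> gt t < 1" if t: "t \<in> {a..<t0}" for t
  proof -
    have "(gs t \<bullet> gs t) * (gt t \<bullet> gt t - 1) < 0"
      using assms(9) line[OF t] metric[OF t] by (auto simp: timelike_on_def det_2)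
    then show "gs t \<noteq> 0" "gt t \<bullet> gt t < 1"
      using inner_ge_zero[of "gs t"] by (auto simp: mult_less_0_iff)
  qed
  have accel: "\<bar>gt t \<bullet> gtt t\<bar> \<le> (1 - gt t \<bullet> gt t) * (k t + C)" if t: "t \<in> {a..<t0}" for t
  proof -
    note p = line[OF t]
    define n where "n = snd (\<nu> (s0, t))"
    have nrm: "minkowski (\<nu> (s0, t)) (partial i \<phi> (s0, t)) = 0" for i
      using assms(12)[OF p] unfolding unit_normal_def partial_eq_frechet_derivative[OF diff(1)[OF p]]
      by blast
    \<comment> \<open>Orthogonality to \<open>\<phi>\<^sub>t\<close>, which is
      \<open>(1, gt t)\<close>, fixes the time component of the normal.\<close>
    have n1: "n \<bullet> gs t = 0" and n2: "fst (\<nu> (s0, t)) = n \<bullet> gt t"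
      using nrm[of 1] nrm[of 2] d\<phi>[OF p] by (simp_all add: minkowski_def n_def gs_def gt_def)
    have n3: "n \<bullet> n - (n \<bullet> gt t)\<^sup>2 = 1"
      using assms(12)[OF p] n2 by (simp add: unit_normal_def minkowski_def n_def power2_eq_square)
    have "mean_curvature \<phi> \<nu> (s0, t) = gss t \<bullet> n / (gs t \<bullet> gs t) + gtt t \<bullet> n / (gt t \<bullet> gt t - 1)"
      unfolding mean_curvature_def
      by (subst trace_matrix_inv_diagonal_2)
        (use metric[OF t] timelike[OF t] dd\<phi>[OF p] in
          \<open>simp_all add: second_fundamental_matrix_def minkowski_def n_def gss_def gtt_def\<close>)
    then have H: "\<bar>gss t \<bullet> n / (gs t \<bullet> gs t) + gtt t \<bullet> n / (gt t \<bullet> gt t - 1)\<bar> \<le> C"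
      using assms(13)[OF p] by simp
    have "\<bar>gt t \<bullet> gtt t\<bar> \<le> (1 - gt t \<bullet> gt t) *
        (k t + \<bar>gss t \<bullet> n / (gs t \<bullet> gs t) + gtt t \<bullet> n / (gt t \<bullet> gt t - 1)\<bar>)"
      unfolding k by (rule acceleration_bound[OF timelike(1)[OF t] orth[OF t] timelike(2)[OF t] n1 n3])
    also have "\<dots> \<le> (1 - gt t \<bullet> gt t) * (k t + C)"
      using timelike(2)[OF t] H by (intro mult_left_mono) auto
    finally show ?thesis .
  qed

  \<comment> \<open>Continuity of k and the limit of 1 - |\<gamma>_t|^2 at t0\<close>
  have contk: "continuous_on {a..<t0} k"
  proof -
    have line_cont: "continuous_on {a..<t0} (\<lambda>t. f (s0, t))" if "continuous_on \<Omega> f"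
      for f :: "real \<times> real \<Rightarrow> real^2"
      by (rule continuous_on_compose2[OF that]) (use line in \<open>auto intro!: continuous_intros\<close>)
    have "continuous_on {a..<t0} gs" "continuous_on {a..<t0} gss"
      unfolding gs_def gss_def using \<gamma>2 by (auto intro!: line_cont simp: C2_on_def C1_on_def)
    then show ?thesis
      unfolding k[abs_def] using timelike(1) by (intro continuous_intros) auto
  qed
  have der: "((\<lambda>t. 1 - gt t \<bullet> gt t) has_real_derivative - 2 * (gt t \<bullet> gtt t)) (at t)"
    if t: "t \<in> {a..<t0}" for t
  proof -
    have "(gt has_vector_derivative gtt t) (at t)"
      unfolding gt_def gtt_def using \<gamma>2 line[OF t]
      by (intro has_vector_derivative_partial_2) (auto simp: C2_on_def C1_on_def)
    then show ?thesis
      unfolding has_vector_derivative_def has_field_derivative_def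
      by (auto intro!: derivative_eq_intros simp: inner_commute algebra_simps)
  qed
  have lim: "((\<lambda>t. 1 - gt t \<bullet> gt t) \<longlongrightarrow> 0) (at_left t0)"
  proof -
    \<comment> \<open>The hypothesis provides an extension of \<open>\<phi>\<^sub>t\<close>; its
      spatial part is the limit of \<open>\<gamma>\<^sub>t\<close> that \<open>partial_ext\<close>
      denotes.\<close>
    obtain g where g: "continuous_on (closure \<Omega>) g" "\<And>p. p \<in> \<Omega> \<Longrightarrow> g p = partial 2 \<phi> p"
      using assms(6) unfolding C1_on_closure_def by blast
    have cl: "(s0, t0) \<in> closure \<Omega>" and not: "(s0, t0) \<notin> \<Omega>"
      using assms(1,5) by (auto simp: frontier_def interior_open)
    have "(g \<longlongrightarrow> g (s0, t0)) (at (s0, t0) within \<Omega>)"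
      by (rule tendsto_within_subset[OF g(1)[unfolded continuous_on_def, rule_format, OF cl] closure_subset])
    then have "((\<lambda>p. snd (g p)) \<longlongrightarrow> snd (g (s0, t0))) (at (s0, t0) within \<Omega>)"
      by (rule tendsto_snd)
    moreover have "\<forall>\<^sub>F p in at (s0, t0) within \<Omega>. snd (g p) = partial 2 \<gamma> p"
      by (simp add: eventually_at_filter g(2) d\<phi>)
    ultimately have L: "(partial 2 \<gamma> \<longlongrightarrow> snd (g (s0, t0))) (at (s0, t0) within \<Omega>)"
      using tendsto_cong by force
    \<comment> \<open>\<open>Lim\<close> is determined only at a limit point of \<Omega>;
      \<open>(s0, t0)\<close> is one, being in the closure but not in \<Omega>.\<close>
    have "\<not> trivial_limit (at (s0, t0) within \<Omega>)"
      using cl not by (simp add: trivial_limit_within closure_def)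
    then have "partial_ext \<Omega> 2 \<gamma> (s0, t0) = snd (g (s0, t0))"
      using L unfolding partial_ext_def by (rule tendsto_Lim)
    then have unit: "snd (g (s0, t0)) \<bullet> snd (g (s0, t0)) = 1"
      using assms(14) by (simp add: power2_norm_eq_inner)
    have "filterlim (\<lambda>t. (s0, t)) (at (s0, t0) within \<Omega>) (at_left t0)"
      unfolding filterlim_at
    proof (intro conjI)
      show "\<forall>\<^sub>F t in at_left t0. (s0, t) \<in> \<Omega> \<and> (s0, t) \<noteq> (s0, t0)"
        using eventually_at_left_real[OF ab] by eventually_elim (use line in auto)
      show "((\<lambda>t. (s0, t)) \<longlongrightarrow> (s0, t0)) (at_left t0)" by (intro tendsto_intros)
    qed
    from filterlim_compose[OF L this] have "(gt \<longlongrightarrow> snd (g (s0, t0))) (at_left t0)"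
      by (simp add: gt_def[abs_def])
    then have "((\<lambda>t. 1 - gt t \<bullet> gt t) \<longlongrightarrow> 1 - snd (g (s0, t0)) \<bullet> snd (g (s0, t0))) (at_left t0)"
      by (intro tendsto_intros)
    then show ?thesis using unit by simp
  qed
  \<comment> \<open>Here \<open>u\<close> is \<open>1 - gt t \<bullet> gt t\<close>; the factor 2 in
    the bound comes from differentiating the square.\<close>
  have int: "(\<integral>\<^sup>+t\<in>{a..<t0}. ennreal (k t) \<partial>lborel) = \<infinity>"
  proof (rule nn_integral_infinite_if_log_derivative_bounded[OF ab der _ _ _ contk lim])
    show "\<bar>- 2 * (gt t \<bullet> gtt t)\<bar> \<le> (1 - gt t \<bullet> gt t) * (2 * (k t + C))" if "t \<in> {a..<t0}" for t
      using accel[OF that] by (simp add: abs_mult algebra_simps)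
  qed (use timelike(2) in \<open>auto simp: k_def\<close>)
  moreover have "Limsup (at_left t0) (\<lambda>t. ereal (k t)) = \<infinity>"
    by (rule Limsup_at_left_infinite_if_nn_integral_infinite[OF ab contk int])
  ultimately show ?thesis by (simp add: k_def a_def)
qed

end
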